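(* Let $t_0\ge 0$, let $\gamma,\delta,\sigma>0$ be constants, let $A\in\mathbb{R}^{m\times n}$, $b\in\mathbb{R}^m$, and let $f:\mathbb{R}^n\to\mathbb{R}\cup\{+\infty\}$ be proper, convex and continuously differentiable. Assume that $\beta(t)=\mu e^{t/\delta}$ with $\mu>0$, and that $\gamma\delta>1$. Let $(x(t),\lambda(t))$ be a global solution on $[t_0,+\infty)$ of the dynamical system $$\begin{cases}\ddot x(t)+\gamma\dot x(t)=-\beta(t)\big(\nabla f(x(t))+A^T\lambda(t)+\sigma A^T(Ax(t)-b)\big),\\ \dot\lambda(t)=\beta(t)\big(A(x(t)+\delta\dot x(t))-b\big),\end{cases}$$ and let $(x^*,\lambda^* )\in\Omega$. Then, as $t\to+\infty$, $$|f(x(t))-f(x^* )|=\mathcal{O}\left(\frac1{e^{t/\delta}}\right),\qquad \|Ax(t)-b\|=\mathcal{O}\left(\frac1{e^{t/\delta}}\right).$$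
   Context: Norms and inner products are Euclidean. Since $f$ is differentiable on $\mathbb{R}^n$, it is finite everywhere and $\nabla f$ is defined on all of $\mathbb{R}^n$. The underlying problem is $\min_x f(x)$ subject to $Ax=b$, with Lagrangian $\mathcal{L}(x,\lambda)=f(x)+\langle\lambda,Ax-b\rangle$. A pair $(x^*,\lambda^* )\in\mathbb{R}^n\times\mathbb{R}^m$ is a saddle point of $\mathcal{L}$ if $\mathcal{L}(x^*,\lambda)\le\mathcal{L}(x^*,\lambda^* )\le\mathcal{L}(x,\lambda^* )$ for all $(x,\lambda)\in\mathbb{R}^n\times\mathbb{R}^m$; equivalently, $-A^T\lambda^*=\nabla f(x^* )$ and $Ax^*=b$. $\Omega$ denotes the set of saddle points of $\mathcal{L}$. A global solution is a pair with $x\in\mathcal{C}^2([t_0,+\infty),\mathbb{R}^n)$ and $\lambda\in\mathcal{C}^1([t_0,+\infty),\mathbb{R}^m)$ satisfying the system for all $t\ge t_0$. *)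

theory Defs
  imports "HOL-Analysis.Analysis" "HOL-Library.Landau_Symbols"
begin

definition gradient :: "('a::euclidean_space \<Rightarrow> real) \<Rightarrow> 'a \<Rightarrow> 'a" where
  "gradient f x = (THE D. GDERIV f x :> D)"

lemma gradient_eqI:
  assumes "GDERIV f x :> D"
  shows "gradient f x = D"
  unfolding gradient_def
proof (rule the_equality)
  fix D' assume "GDERIV f x :> D'"
  with assms have "(\<lambda>h. h \<bullet> D') = (\<lambda>h. h \<bullet> D)"
    unfolding gderiv_def by (blast intro: has_derivative_unique)
  then have "h \<bullet> D' = h \<bullet> D" for h
    by (rule fun_cong)
  then show "D' = D"
    using vector_eq_ldot by blast
qed (rule assms)

lemma GDERIV_gradient:
  fixes f :: "'a::euclidean_space \<Rightarrow> real"
  assumes "f differentiable (at x)"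
  shows "GDERIV f x :> gradient f x"
proof -
  from assms obtain L where L: "(f has_derivative L) (at x)"
    by (auto simp: differentiable_def)
  have "h \<bullet> adjoint L 1 = L h" for h
    using adjoint_works[OF has_derivative_linear[OF L], of h 1] by simp
  then have "L = (\<lambda>h. h \<bullet> adjoint L 1)"
    by (intro ext) (rule sym)
  then have "GDERIV f x :> adjoint L 1"
    unfolding gderiv_def by (rule has_derivative_eq_rhs[OF L])
  with gradient_eqI[OF this] show ?thesis
    by simp
qed

definition continuously_differentiable :: "('a::euclidean_space \<Rightarrow> real) \<Rightarrow> bool" where
  "continuously_differentiable f \<longleftrightarrow>
     (\<forall>x. f differentiable (at x)) \<and> continuous_on UNIV (gradient f)"

text \<open>Derivatives with respect to time are relative to the half-line, hence
  one-sided at the initial time; values before the initial time are irrelevant.\<close>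

definition tderiv :: "real \<Rightarrow> (real \<Rightarrow> 'a::real_normed_vector) \<Rightarrow> real \<Rightarrow> 'a" where
  "tderiv t0 x t = vector_derivative x (at t within {t0..})"

definition C1_from :: "real \<Rightarrow> (real \<Rightarrow> 'a::real_normed_vector) \<Rightarrow> bool" where
  "C1_from t0 x \<longleftrightarrow> x differentiable_on {t0..} \<and> continuous_on {t0..} (tderiv t0 x)"

definition C2_from :: "real \<Rightarrow> (real \<Rightarrow> 'a::real_normed_vector) \<Rightarrow> bool" where
  "C2_from t0 x \<longleftrightarrow> C1_from t0 x \<and> C1_from t0 (tderiv t0 x)"

definition Lagrangian ::
  "(real^'n \<Rightarrow> real) \<Rightarrow> real^'n^'m \<Rightarrow> real^'m \<Rightarrow> real^'n \<Rightarrow> real^'m \<Rightarrow> real" where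
  "Lagrangian f A b x l = f x + l \<bullet> (A *v x - b)"

definition saddle_points ::
  "(real^'n \<Rightarrow> real) \<Rightarrow> real^'n^'m \<Rightarrow> real^'m \<Rightarrow> ((real^'n) \<times> (real^'m)) set" where
  "saddle_points f A b = {(xs, ls). \<forall>x l.
     Lagrangian f A b xs l \<le> Lagrangian f A b xs ls \<and>
     Lagrangian f A b xs ls \<le> Lagrangian f A b x ls}"

definition global_solution ::
  "real \<Rightarrow> real \<Rightarrow> real \<Rightarrow> real \<Rightarrow> (real \<Rightarrow> real) \<Rightarrow> (real^'n \<Rightarrow> real) \<Rightarrow> real^'n^'m \<Rightarrow> real^'m
    \<Rightarrow> (real \<Rightarrow> real^'n) \<Rightarrow> (real \<Rightarrow> real^'m) \<Rightarrow> bool" where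
  "global_solution t0 \<gamma> \<delta> \<sigma> \<beta> f A b x l \<longleftrightarrow>
     C2_from t0 x \<and> C1_from t0 l \<and>
     (\<forall>t\<ge>t0.
        tderiv t0 (tderiv t0 x) t + \<gamma> *\<^sub>R tderiv t0 x t =
          - (\<beta> t *\<^sub>R (gradient f (x t) + transpose A *v l t
                       + \<sigma> *\<^sub>R (transpose A *v (A *v x t - b)))) \<and>
        tderiv t0 l t = \<beta> t *\<^sub>R (A *v (x t + \<delta> *\<^sub>R tderiv t0 x t) - b))"

end

theory Submission
  imports Defs
begin

text \<open>Write \<open>r = A x - b\<close> and \<open>G(y) = f(y) - f(x*) + \<lambda>* \<bullet> (A y - b) + \<sigma>/2 |A y - b|\<^sup>2\<close>, which is
  nonnegative by the saddle point property. The energy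
  \<open>|x - x* + \<delta> x'|\<^sup>2/2 + (\<gamma>\<delta> - 1)/2 |x - x*|\<^sup>2 + \<delta>/2 |\<lambda> - \<lambda>*|\<^sup>2 + \<delta>\<^sup>2 \<beta> G(x)\<close>
  is nonincreasing because \<open>\<delta> \<beta>' = \<beta>\<close> and \<open>f\<close> is convex. Hence \<open>\<beta> G(x)\<close> and \<open>\<lambda>\<close> are bounded.
  For the exponential \<open>\<beta>\<close> the multiplier equation reads \<open>\<lambda>' = (\<delta> \<beta> r)'\<close>, so \<open>\<lambda> - \<delta> \<beta> r\<close> is
  constant and \<open>\<beta> r\<close> is bounded as well, which upgrades the rate \<open>\<beta>\<^sup>-\<^sup>1\<^sup>/\<^sup>2\<close> of \<open>r\<close> coming from \<open>G\<close>
  to \<open>1/\<beta>\<close>.\<close>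

section \<open>Convexity and saddle points\<close>

lemma convex_on_gradient_le:
  fixes f :: "'a::euclidean_space \<Rightarrow> real"
  assumes "convex_on UNIV f" and "f differentiable (at x)"
  shows "f x - f y \<le> gradient f x \<bullet> (x - y)"
proof -
  \<comment> \<open>Restricting \<open>f\<close> to the line through \<open>x\<close> and
    \<open>y\<close> reduces the claim to the tangent inequality for a convex function of one real
    variable, with tangent at 0 and evaluation at 1.\<close>
  define g where "g = (\<lambda>s. f (x + s *\<^sub>R (y - x)))"
  have D: "(f has_derivative (\<lambda>h. h \<bullet> gradient f x)) (at (x + 0 *\<^sub>R (y - x)))"
    using GDERIV_gradient[OF assms(2)] by (simp add: gderiv_def)
  have "((\<lambda>s. x + s *\<^sub>R (y - x)) has_derivative (\<lambda>s. s *\<^sub>R (y - x))) (at 0)"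
    by (auto intro!: derivative_eq_intros)
  from has_derivative_compose[OF this D]
  have "(g has_real_derivative ((y - x) \<bullet> gradient f x)) (at 0)"
    by (simp add: has_field_derivative_def g_def mult.commute[of _ "(y - x) \<bullet> gradient f x"])
  moreover have "convex_on UNIV g"
  proof (rule convex_onI)
    fix t a c :: real
    assume "0 < t" "t < 1"
    have "x + ((1 - t) * a + t * c) *\<^sub>R (y - x)
        = (1 - t) *\<^sub>R (x + a *\<^sub>R (y - x)) + t *\<^sub>R (x + c *\<^sub>R (y - x))"
      by (simp add: algebra_simps)
    then show "g ((1 - t) *\<^sub>R a + t *\<^sub>R c) \<le> (1 - t) * g a + t * g c"
      using convex_onD[OF assms(1), of t] \<open>0 < t\<close> \<open>t < 1\<close> by (simp add: g_def)
  qed simp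
  ultimately have "g 1 - g 0 \<ge> ((y - x) \<bullet> gradient f x) * (1 - 0)"
    by (intro convex_on_imp_above_tangent[where A = UNIV]) auto
  then show ?thesis
    by (simp add: g_def inner_commute inner_diff_left algebra_simps)
qed

lemma saddle_point_feasible:
  assumes "(xs, ls) \<in> saddle_points f A b"
  shows "A *v xs = b"
proof -
  \<comment> \<open>The Lagrangian is affine in the multiplier, so shifting the multiplier by the
    residual raises it by the squared norm of the residual. Maximality at \<open>ls\<close> leaves
    no room for this.\<close>
  have "Lagrangian f A b xs (ls + (A *v xs - b)) \<le> Lagrangian f A b xs ls"
    using assms by (auto simp: saddle_points_def)
  then have "(A *v xs - b) \<bullet> (A *v xs - b) \<le> 0"
    by (simp add: Lagrangian_def inner_add_left)
  then show ?thesis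
    by (metis eq_iff_diff_eq_0 inner_eq_zero_iff inner_ge_zero order_antisym)
qed

lemma saddle_point_minimizes:
  assumes "(xs, ls) \<in> saddle_points f A b"
  shows "f xs \<le> f y + ls \<bullet> (A *v y - b)"
proof -
  have "Lagrangian f A b xs ls \<le> Lagrangian f A b y ls"
    using assms by (auto simp: saddle_points_def)
  then show ?thesis
    by (simp add: Lagrangian_def saddle_point_feasible[OF assms])
qed

section \<open>Calculus along trajectories on the half-line\<close>

lemma C1_from_has_tderiv:
  assumes "C1_from t0 x" and "t \<ge> t0"
  shows "(x has_vector_derivative tderiv t0 x t) (at t within {t0..})"
  using assms unfolding C1_from_def tderiv_def
  by (auto simp: differentiable_on_def vector_derivative_works)

lemma has_vector_derivative_inner_self:
  fixes u :: "real \<Rightarrow> 'a::real_inner"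
  assumes "(u has_vector_derivative u') (at t within S)"
  shows "((\<lambda>t. u t \<bullet> u t) has_real_derivative 2 * (u t \<bullet> u')) (at t within S)"
  using bounded_bilinear.has_vector_derivative[OF bounded_bilinear_inner assms assms]
  by (simp add: has_real_derivative_iff_has_vector_derivative inner_commute)

lemma has_real_derivative_comp_gradient:
  fixes f :: "'a::euclidean_space \<Rightarrow> real"
  assumes "f differentiable (at (x t))"
    and "(x has_vector_derivative v) (at t within S)"
  shows "((\<lambda>t. f (x t)) has_real_derivative gradient f (x t) \<bullet> v) (at t within S)"
proof -
  have "(f has_derivative (\<lambda>h. h \<bullet> gradient f (x t))) (at (x t))"
    using GDERIV_gradient[OF assms(1)] by (simp add: gderiv_def)
  from has_derivative_compose[OF assms(2)[unfolded has_vector_derivative_def] this]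
  show ?thesis
    by (simp add: has_field_derivative_def inner_commute[of "gradient f (x t)"] mult_commute_abs)
qed

lemma matrix_vector_has_vector_derivative:
  fixes A :: "real^'n^'m"
  assumes "(x has_vector_derivative v) F"
  shows "((\<lambda>t. A *v x t) has_vector_derivative A *v v) F"
  using bounded_linear.has_vector_derivative[OF matrix_vector_mul_bounded_linear assms] .

lemma has_real_derivative_nonpos_imp_le_left:
  fixes E :: "real \<Rightarrow> real"
  assumes deriv: "\<And>t. t \<ge> t0 \<Longrightarrow> (E has_real_derivative E' t) (at t within {t0..})"
    and nonpos: "\<And>t. t \<ge> t0 \<Longrightarrow> E' t \<le> 0"
    and "t \<ge> t0"
  shows "E t \<le> E t0"
proof (rule DERIV_nonpos_imp_decreasing_open[OF \<open>t \<ge> t0\<close>])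
  \<comment> \<open>Away from \<open>t0\<close> the one-sided derivative is an ordinary one. At
    \<open>t0\<close> itself only continuity enters.\<close>
  fix s assume s: "t0 < s" "s < t"
  then have "(E has_real_derivative E' s) (at s)"
    using deriv[of s] at_within_interior[of s "{t0..}"] by simp
  then show "\<exists>y. (E has_real_derivative y) (at s) \<and> y \<le> 0"
    using nonpos[of s] s by auto
next
  have "continuous_on {t0..} E"
    unfolding continuous_on_eq_continuous_within using deriv DERIV_continuous by blast
  then show "continuous_on {t0..t} E"
    by (rule continuous_on_subset) auto
qed

section \<open>The Lyapunov energy and its dissipation\<close>

definition augmented_gap ::
  "real \<Rightarrow> (real^'n \<Rightarrow> real) \<Rightarrow> real^'n^'m \<Rightarrow> real^'m \<Rightarrow> real^'n \<Rightarrow> real^'m \<Rightarrow> real^'n \<Rightarrow> real" where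
  "augmented_gap \<sigma> f A b xs ls y =
     f y - f xs + ls \<bullet> (A *v y - b) + \<sigma> / 2 * ((A *v y - b) \<bullet> (A *v y - b))"

text \<open>The weights are dictated by cancellation: \<gamma>\<delta> - 1 removes the product of
  \<open>x t - xs\<close> and \<open>v t\<close>, \<delta> removes the coupling of
  \<open>l t\<close> with the primal equation, and \<delta> squared removes the product of the
  gradient and \<open>v t\<close>.\<close>

definition energy where
  "energy \<gamma> \<delta> \<sigma> \<beta> f A b xs ls x v l t =
     1 / 2 * ((x t - xs + \<delta> *\<^sub>R v t) \<bullet> (x t - xs + \<delta> *\<^sub>R v t))
     + (\<gamma> * \<delta> - 1) / 2 * ((x t - xs) \<bullet> (x t - xs))
     + \<delta> / 2 * ((l t - ls) \<bullet> (l t - ls))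
     + \<delta>\<^sup>2 * \<beta> t * augmented_gap \<sigma> f A b xs ls (x t)"

text \<open>Since \<open>xs\<close> is feasible, the gap is the increment of the augmented
  Lagrangian at multiplier \<open>ls\<close> from \<open>xs\<close> to \<open>y\<close>: a saddle
  point inequality plus a penalty.\<close>

lemma augmented_gap_nonneg:
  assumes "(xs, ls) \<in> saddle_points f A b" and "\<sigma> \<ge> 0"
  shows "augmented_gap \<sigma> f A b xs ls y \<ge> 0"
proof -
  have "\<sigma> / 2 * ((A *v y - b) \<bullet> (A *v y - b)) \<ge> 0"
    using assms(2) by simp
  then show ?thesis
    using saddle_point_minimizes[OF assms(1), of y] by (simp add: augmented_gap_def)
qed

text \<open>Everything without a sign cancels. What survives is a multiple of the defect in the
  tangent inequality of \<open>f\<close>, half of the penalty, and the friction left over when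
  \<gamma>\<delta> exceeds 1.\<close>

lemma energy_has_real_derivative:
  fixes A :: "real^'n^'m"
  assumes x: "(x has_vector_derivative v t) (at t within S)"
    and v: "(v has_vector_derivative w) (at t within S)"
    and l: "(l has_vector_derivative q) (at t within S)"
    and \<beta>: "(\<beta> has_real_derivative \<beta> t / \<delta>) (at t within S)"
    and f: "f differentiable (at (x t))"
    and w: "w + \<gamma> *\<^sub>R v t = - (\<beta> t *\<^sub>R (gradient f (x t) + transpose A *v l t
              + \<sigma> *\<^sub>R (transpose A *v (A *v x t - b))))"
    and q: "q = \<beta> t *\<^sub>R (A *v (x t + \<delta> *\<^sub>R v t) - b)"
    and b: "A *v xs = b" and "\<delta> > 0"
  shows "(energy \<gamma> \<delta> \<sigma> \<beta> f A b xs ls x v l has_real_derivative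
     - \<delta> * \<beta> t * (gradient f (x t) \<bullet> (x t - xs) - (f (x t) - f xs)
                 + \<sigma> / 2 * ((A *v x t - b) \<bullet> (A *v x t - b)))
     - \<delta> * (\<gamma> * \<delta> - 1) * (v t \<bullet> v t)) (at t within S)"
proof -
  define r where "r = (\<lambda>t. A *v x t - b)"
  have r: "A *v x s - b = r s" for s
    by (simp add: r_def)
  let ?g = "gradient f (x t)"
  let ?u = "x t - xs + \<delta> *\<^sub>R v t"
  have u: "((\<lambda>t. x t - xs + \<delta> *\<^sub>R v t) has_vector_derivative v t + \<delta> *\<^sub>R w) (at t within S)"
    using x v by (auto intro!: derivative_eq_intros)
  have xd: "((\<lambda>t. x t - xs) has_vector_derivative v t) (at t within S)"
    using x by (auto intro!: derivative_eq_intros)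
  have ld: "((\<lambda>t. l t - ls) has_vector_derivative q) (at t within S)"
    using l by (auto intro!: derivative_eq_intros)
  have rd: "(r has_vector_derivative A *v v t) (at t within S)"
    unfolding r_def using matrix_vector_has_vector_derivative[OF x, of A]
    by (auto intro!: derivative_eq_intros)
  have lsr: "((\<lambda>t. ls \<bullet> r t) has_real_derivative ls \<bullet> (A *v v t)) (at t within S)"
    using bounded_linear.has_vector_derivative[OF bounded_linear_inner_right rd, of ls]
    by (simp add: has_real_derivative_iff_has_vector_derivative)
  let ?G' = "?g \<bullet> v t + ls \<bullet> (A *v v t) + \<sigma> * (r t \<bullet> (A *v v t))"
  have G: "((\<lambda>t. augmented_gap \<sigma> f A b xs ls (x t)) has_real_derivative ?G') (at t within S)"
    unfolding augmented_gap_def r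
    by (rule DERIV_cong, (rule derivative_intros has_vector_derivative_inner_self[OF rd] lsr
          has_real_derivative_comp_gradient[OF f x])+) simp
  have "(energy \<gamma> \<delta> \<sigma> \<beta> f A b xs ls x v l has_real_derivative
      (?u \<bullet> (v t + \<delta> *\<^sub>R w)) + (\<gamma> * \<delta> - 1) * ((x t - xs) \<bullet> v t) + \<delta> * ((l t - ls) \<bullet> q)
      + \<delta>\<^sup>2 * (\<beta> t / \<delta> * augmented_gap \<sigma> f A b xs ls (x t) + \<beta> t * ?G')) (at t within S)"
    unfolding energy_def[abs_def]
    by (rule DERIV_cong, (rule derivative_intros has_vector_derivative_inner_self[OF u]
          has_vector_derivative_inner_self[OF xd] has_vector_derivative_inner_self[OF ld] \<beta> G)+)
      (simp add: field_simps)
  moreover have "(?u \<bullet> (v t + \<delta> *\<^sub>R w)) + (\<gamma> * \<delta> - 1) * ((x t - xs) \<bullet> v t) + \<delta> * ((l t - ls) \<bullet> q)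
      + \<delta>\<^sup>2 * (\<beta> t / \<delta> * augmented_gap \<sigma> f A b xs ls (x t) + \<beta> t * ?G')
      = - \<delta> * \<beta> t * (?g \<bullet> (x t - xs) - (f (x t) - f xs) + \<sigma> / 2 * (r t \<bullet> r t))
        - \<delta> * (\<gamma> * \<delta> - 1) * (v t \<bullet> v t)"
  proof -
    have Au: "A *v ?u = r t + \<delta> *\<^sub>R (A *v v t)"
      using b by (simp add: r_def matrix_vector_right_distrib matrix_vector_mult_diff_distrib
          matrix_vector_mult_scaleR)
    \<comment> \<open>Adjointness moves \<open>A\<close> onto \<open>?u\<close>, and feasibility of
      \<open>xs\<close> turns \<open>A *v ?u\<close> into the very combination that drives the
      multiplier in \<open>q\<close>. This is why the multiplier terms match.\<close>
    have T: "?u \<bullet> (transpose A *v y) = r t \<bullet> y + \<delta> * ((A *v v t) \<bullet> y)" for y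
      using dot_lmul_matrix[of y A ?u] Au
      by (simp add: inner_commute inner_add_right)
    \<comment> \<open>The splitting isolates \<open>w + \<gamma> *\<^sub>R v t\<close>, the
      left-hand side of the equation of motion.\<close>
    have "v t + \<delta> *\<^sub>R w = (1 - \<gamma> * \<delta>) *\<^sub>R v t + \<delta> *\<^sub>R (w + \<gamma> *\<^sub>R v t)"
      by (simp add: algebra_simps)
    also have "\<dots> = (1 - \<gamma> * \<delta>) *\<^sub>R v t - (\<delta> * \<beta> t) *\<^sub>R ?g
        - (\<delta> * \<beta> t) *\<^sub>R (transpose A *v l t) - (\<delta> * \<beta> t * \<sigma>) *\<^sub>R (transpose A *v r t)"
      by (simp add: w r algebra_simps)
    finally have "?u \<bullet> (v t + \<delta> *\<^sub>R w) = (1 - \<gamma> * \<delta>) * (?u \<bullet> v t) - \<delta> * \<beta> t * (?u \<bullet> ?g)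
        - \<delta> * \<beta> t * (r t \<bullet> l t + \<delta> * ((A *v v t) \<bullet> l t))
        - \<delta> * \<beta> t * \<sigma> * (r t \<bullet> r t + \<delta> * ((A *v v t) \<bullet> r t))"
      by (simp only: inner_diff_right inner_scaleR_right T)
    moreover have "q = \<beta> t *\<^sub>R (r t + \<delta> *\<^sub>R (A *v v t))"
      by (simp add: q r_def matrix_vector_right_distrib matrix_vector_mult_scaleR)
    then have "(l t - ls) \<bullet> q = \<beta> t * (r t \<bullet> l t + \<delta> * ((A *v v t) \<bullet> l t)
        - ls \<bullet> r t - \<delta> * (ls \<bullet> (A *v v t)))"
      by (simp add: inner_diff_left inner_add_right inner_commute algebra_simps)
    moreover have "?u \<bullet> v t = (x t - xs) \<bullet> v t + \<delta> * (v t \<bullet> v t)"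
        "?u \<bullet> ?g = ?g \<bullet> (x t - xs) + \<delta> * (?g \<bullet> v t)"
      by (simp_all add: inner_add_left inner_add_right inner_commute)
    \<comment> \<open>Differentiating the weight yields the gap with factor \<delta>\<beta>; its
      term \<open>ls \<bullet> r t\<close> cancels the one from the multiplier, and its penalty
      halves the dissipated one.\<close>
    moreover have "\<delta>\<^sup>2 * (\<beta> t / \<delta> * G + \<beta> t * c) = \<delta> * \<beta> t * G + \<delta>\<^sup>2 * \<beta> t * c" for G c :: real
      using \<open>\<delta> > 0\<close> by (simp add: field_simps power2_eq_square)
    ultimately show ?thesis
      by (simp add: augmented_gap_def r inner_commute[of "A *v v t" "r t"])
        (simp add: field_simps power2_eq_square)
  qed
  ultimately show ?thesis
    by (simp add: r)
qed

text \<open>All four summands of the energy are nonnegative, so each one is at most the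
  whole.\<close>

lemma energy_bounds:
  assumes "(xs, ls) \<in> saddle_points f A b" and "\<sigma> \<ge> 0" and "\<delta> > 0" and "\<gamma> * \<delta> \<ge> 1" and "\<beta> t \<ge> 0"
  shows "\<delta> / 2 * (norm (l t - ls))\<^sup>2 \<le> energy \<gamma> \<delta> \<sigma> \<beta> f A b xs ls x v l t"
    and "\<delta>\<^sup>2 * \<beta> t * augmented_gap \<sigma> f A b xs ls (x t) \<le> energy \<gamma> \<delta> \<sigma> \<beta> f A b xs ls x v l t"
proof -
  have "0 \<le> \<delta>\<^sup>2 * \<beta> t * augmented_gap \<sigma> f A b xs ls (x t)"
    using augmented_gap_nonneg[OF assms(1,2), of "x t"] assms(3-) by simp
  moreover have "0 \<le> (\<gamma> * \<delta> - 1) / 2 * ((x t - xs) \<bullet> (x t - xs))"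
    "0 \<le> \<delta> / 2 * ((l t - ls) \<bullet> (l t - ls))"
    using assms by simp_all
  ultimately show "\<delta> / 2 * (norm (l t - ls))\<^sup>2 \<le> energy \<gamma> \<delta> \<sigma> \<beta> f A b xs ls x v l t"
    "\<delta>\<^sup>2 * \<beta> t * augmented_gap \<sigma> f A b xs ls (x t) \<le> energy \<gamma> \<delta> \<sigma> \<beta> f A b xs ls x v l t"
    unfolding energy_def power2_norm_eq_inner
    using inner_ge_zero[of "x t - xs + \<delta> *\<^sub>R v t"] by linarith+
qed

section \<open>Convergence rates\<close>

lemma bigo_inverse_exp_if_bounded:
  fixes h \<beta> :: "real \<Rightarrow> real"
  assumes "\<mu> > 0" and "\<And>t. t \<ge> t0 \<Longrightarrow> \<beta> t = \<mu> * exp (t / \<delta>)"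
    and "\<And>t. t \<ge> t0 \<Longrightarrow> \<beta> t * \<bar>h t\<bar> \<le> C"
  shows "h \<in> O[at_top](\<lambda>t. 1 / exp (t / \<delta>))"
proof (rule bigoI[where c = "C / \<mu>"])
  show "\<forall>\<^sub>F t in at_top. norm (h t) \<le> C / \<mu> * norm (1 / exp (t / \<delta>))"
    using eventually_ge_at_top[of t0]
  proof eventually_elim
    case (elim t)
    then have "\<mu> * exp (t / \<delta>) * \<bar>h t\<bar> \<le> C"
      using assms(2,3)[of t] by simp
    then show ?case
      using \<open>\<mu> > 0\<close> by (simp add: field_simps)
  qed
qed

theorem mainTheorem3:
  fixes t0 \<gamma> \<delta> \<sigma> \<mu> :: real
    and \<beta> :: "real \<Rightarrow> real"
    and A :: "real^'n^'m" and b :: "real^'m"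
    and f :: "real^'n \<Rightarrow> real"
    and x :: "real \<Rightarrow> real^'n" and l :: "real \<Rightarrow> real^'m"
    and xs :: "real^'n" and ls :: "real^'m"
  assumes "t0 \<ge> 0" and "\<gamma> > 0" and "\<delta> > 0" and "\<sigma> > 0" and "\<mu> > 0"
    and "convex_on UNIV f" and "continuously_differentiable f"
    and "\<And>t. t \<ge> t0 \<Longrightarrow> \<beta> t = \<mu> * exp (t / \<delta>)"
    and "\<gamma> * \<delta> > 1"
    and "global_solution t0 \<gamma> \<delta> \<sigma> \<beta> f A b x l"
    and "(xs, ls) \<in> saddle_points f A b"
  shows "(\<lambda>t. \<bar>f (x t) - f xs\<bar>) \<in> O[at_top](\<lambda>t. 1 / exp (t / \<delta>)) \<and>
         (\<lambda>t. norm (A *v x t - b)) \<in> O[at_top](\<lambda>t. 1 / exp (t / \<delta>))"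
proof -
  define v where "v = tderiv t0 x"
  define S where "S = {t0..}"
  define r where "r = (\<lambda>t. A *v x t - b)"
  define E where "E = energy \<gamma> \<delta> \<sigma> \<beta> f A b xs ls x v l"
  note pos = \<open>\<gamma> > 0\<close> \<open>\<delta> > 0\<close> \<open>\<sigma> > 0\<close> \<open>\<mu> > 0\<close> and \<beta> = assms(8) and saddle = assms(11)
  note sol = assms(10)[unfolded global_solution_def C2_from_def, folded v_def]
  have xd: "(x has_vector_derivative v t) (at t within S)"
    and vd: "(v has_vector_derivative tderiv t0 v t) (at t within S)"
    and ld: "(l has_vector_derivative tderiv t0 l t) (at t within S)" if "t \<ge> t0" for t
    using sol C1_from_has_tderiv[OF _ that] unfolding v_def S_def by blast+
  \<comment> \<open>\<beta> is known to be exponential only from \<open>t0\<close> on, so its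
    derivative is transferred within the half-line; the radius 1 is arbitrary.\<close>
  have \<beta>d: "(\<beta> has_real_derivative \<beta> t / \<delta>) (at t within S)" if "t \<ge> t0" for t
  proof (rule has_field_derivative_transform_within[where d = 1])
    show "((\<lambda>t. \<mu> * exp (t / \<delta>)) has_real_derivative \<beta> t / \<delta>) (at t within S)"
      using that pos \<beta> by (auto intro!: derivative_eq_intros)
  qed (use that \<beta> in \<open>auto simp: S_def\<close>)
  have \<beta>pos: "\<beta> t > 0" if "t \<ge> t0" for t
    using \<beta>[OF that] pos by simp
  have f_diff: "f differentiable (at y)" for y
    using assms(7) by (auto simp: continuously_differentiable_def)
  have feasible: "A *v xs = b"
    using saddle by (rule saddle_point_feasible)

  have E_le: "E t \<le> E t0" if "t \<ge> t0" for t
  proof (rule has_real_derivative_nonpos_imp_le_left[OF _ _ that])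
    fix s :: real assume s: "s \<ge> t0"
    let ?g = "gradient f (x s) \<bullet> (x s - xs) - (f (x s) - f xs) + \<sigma> / 2 * (r s \<bullet> r s)"
    show "(E has_real_derivative - \<delta> * \<beta> s * ?g - \<delta> * (\<gamma> * \<delta> - 1) * (v s \<bullet> v s)) (at s within {t0..})"
      unfolding E_def r_def S_def[symmetric]
      using sol s feasible pos
      by (intro energy_has_real_derivative[where w = "tderiv t0 v s" and q = "tderiv t0 l s"]
          xd vd ld \<beta>d f_diff) auto
    \<comment> \<open>Convexity enters here, through the tangent to \<open>f\<close> at
      \<open>x s\<close> evaluated at \<open>xs\<close>.\<close>
    have "?g \<ge> 0"
      using convex_on_gradient_le[OF assms(6) f_diff, of "x s" xs] pos by simp
    then have "0 \<le> \<delta> * \<beta> s * ?g"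
      using pos \<beta>pos[OF s] by (intro mult_nonneg_nonneg) auto
    moreover have "0 \<le> \<delta> * (\<gamma> * \<delta> - 1) * (v s \<bullet> v s)"
      using pos assms(9) by simp
    ultimately show "- \<delta> * \<beta> s * ?g - \<delta> * (\<gamma> * \<delta> - 1) * (v s \<bullet> v s) \<le> 0"
      by simp
  qed
  have gap: "\<beta> t * augmented_gap \<sigma> f A b xs ls (x t) \<le> E t0 / \<delta>\<^sup>2"
    and l_bound: "norm (l t - ls) \<le> sqrt (2 * E t0 / \<delta>)" if "t \<ge> t0" for t
  proof -
    have "\<delta>\<^sup>2 * \<beta> t * augmented_gap \<sigma> f A b xs ls (x t) \<le> E t0"
      using energy_bounds(2)[OF saddle, of \<sigma> \<delta> \<gamma> \<beta> t x v l] pos assms(9) \<beta>pos[OF that] E_le[OF that]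
      by (simp add: E_def)
    then show "\<beta> t * augmented_gap \<sigma> f A b xs ls (x t) \<le> E t0 / \<delta>\<^sup>2"
      using pos by (simp add: field_simps)
    have "\<delta> / 2 * (norm (l t - ls))\<^sup>2 \<le> E t0"
      using energy_bounds(1)[OF saddle, of \<sigma> \<delta> \<gamma> \<beta> t l x v] pos assms(9) \<beta>pos[OF that] E_le[OF that]
      by (simp add: E_def)
    then show "norm (l t - ls) \<le> sqrt (2 * E t0 / \<delta>)"
      using pos by (intro real_le_rsqrt) (simp add: field_simps)
  qed

  obtain c where "l t - (\<delta> * \<beta> t) *\<^sub>R r t = c" if "t \<in> S" for t
  proof (rule has_vector_derivative_zero_constant)
    fix t assume "t \<in> S"
    then have t: "t \<ge> t0"
      by (simp add: S_def)
    have "(r has_vector_derivative A *v v t) (at t within S)"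
      unfolding r_def using matrix_vector_has_vector_derivative[OF xd[OF t], of A]
      by (auto intro!: derivative_eq_intros)
    \<comment> \<open>Because \<delta>\<beta>' = \<beta>, the right-hand side is exactly the product
      rule for \<open>(\<delta> * \<beta> t) *\<^sub>R r t\<close>.\<close>
    moreover have "tderiv t0 l t = (\<delta> * \<beta> t) *\<^sub>R (A *v v t) + \<beta> t *\<^sub>R r t"
      using sol t by (simp add: r_def matrix_vector_right_distrib matrix_vector_mult_scaleR
          algebra_simps)
    ultimately show "((\<lambda>t. l t - (\<delta> * \<beta> t) *\<^sub>R r t) has_vector_derivative 0) (at t within S)"
      using ld[OF t] \<beta>d[OF t] pos by (auto intro!: derivative_eq_intros)
  qed (simp_all add: S_def)
  then have c: "(\<delta> * \<beta> t) *\<^sub>R r t = (l t - ls) + (ls - c)" if "t \<ge> t0" for t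
    using that by (force simp: S_def)
  \<comment> \<open>The energy bounds the distance of \<open>l t\<close> from \<open>ls\<close>,
    while \<open>c\<close> is the conserved vector; centring at \<open>ls\<close> leaves the fixed
    offset \<open>ls - c\<close>.\<close>
  define K where "K = (sqrt (2 * E t0 / \<delta>) + norm (ls - c)) / \<delta>"
  have r_bound: "\<beta> t * norm (r t) \<le> K" if "t \<ge> t0" for t
  proof -
    have "\<delta> * (\<beta> t * norm (r t)) = norm ((l t - ls) + (ls - c))"
      using c[OF that] pos \<beta>pos[OF that] by (metis abs_of_pos mult.assoc mult_pos_pos norm_scaleR)
    also have "\<dots> \<le> sqrt (2 * E t0 / \<delta>) + norm (ls - c)"
      using norm_triangle_ineq[of "l t - ls" "ls - c"] l_bound[OF that] by simp
    finally show ?thesis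
      using pos by (simp add: K_def field_simps)
  qed
  have K: "K \<ge> 0"
    using r_bound[of t0] \<beta>pos[of t0] by (smt (verit) mult_nonneg_nonneg norm_ge_zero)

  \<comment> \<open>The three constants bound, in order, the contributions of the gap, of the
    multiplier term and of the penalty.\<close>
  have "\<beta> t * \<bar>f (x t) - f xs\<bar> \<le> E t0 / \<delta>\<^sup>2 + norm ls * K + \<sigma> / 2 * (K * K / \<mu>)" if t: "t \<ge> t0" for t
  proof -
    \<comment> \<open>As \<open>t\<close> is nonnegative, \<beta> stays above \<mu>, which bounds
      \<open>norm (r t)\<close> uniformly by \<open>K / \<mu>\<close>. In the quadratic penalty one
      factor of the residual absorbs \<beta> and the other uses this bound.\<close>
    have "\<beta> t \<ge> \<mu>"
      using \<beta>[OF t] t assms(1) pos by simp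
    have "\<mu> * norm (r t) \<le> \<beta> t * norm (r t)"
      using \<open>\<beta> t \<ge> \<mu>\<close> by (simp add: mult_right_mono)
    with r_bound[OF t] have "norm (r t) \<le> K / \<mu>"
      using pos by (simp add: field_simps)
    then have "(\<beta> t * norm (r t)) * norm (r t) \<le> K * (K / \<mu>)"
      using r_bound[OF t] K by (intro mult_mono) auto
    then have rr: "\<beta> t * (r t \<bullet> r t) \<le> K * K / \<mu>"
      by (simp add: dot_square_norm power2_eq_square mult.assoc)
    have "\<beta> t * \<bar>ls \<bullet> r t\<bar> \<le> \<beta> t * (norm ls * norm (r t))"
      using Cauchy_Schwarz_ineq2[of ls "r t"] \<beta>pos[OF t] by simp
    also have "\<dots> \<le> norm ls * K"
      using mult_left_mono[OF r_bound[OF t], of "norm ls"] by (simp add: mult_ac)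
    finally have lsr: "\<beta> t * \<bar>ls \<bullet> r t\<bar> \<le> norm ls * K" .
    have "\<bar>f (x t) - f xs\<bar> \<le> augmented_gap \<sigma> f A b xs ls (x t) + \<bar>ls \<bullet> r t\<bar> + \<sigma> / 2 * (r t \<bullet> r t)"
    proof -
      \<comment> \<open>Solving the definition of the gap for the difference of values, which has no
        sign of its own, gives the two-sided estimate.\<close>
      have "f (x t) - f xs = augmented_gap \<sigma> f A b xs ls (x t) - ls \<bullet> r t - \<sigma> / 2 * (r t \<bullet> r t)"
        by (simp add: augmented_gap_def r_def)
      moreover have "augmented_gap \<sigma> f A b xs ls (x t) \<ge> 0" "\<sigma> / 2 * (r t \<bullet> r t) \<ge> 0"
        using augmented_gap_nonneg[OF saddle] pos by simp_all
      ultimately show ?thesis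
        by linarith
    qed
    then have "\<beta> t * \<bar>f (x t) - f xs\<bar>
        \<le> \<beta> t * (augmented_gap \<sigma> f A b xs ls (x t) + \<bar>ls \<bullet> r t\<bar> + \<sigma> / 2 * (r t \<bullet> r t))"
      using \<beta>pos[OF t] by (intro mult_left_mono) auto
    also have "\<dots> = \<beta> t * augmented_gap \<sigma> f A b xs ls (x t) + \<beta> t * \<bar>ls \<bullet> r t\<bar>
        + \<sigma> / 2 * (\<beta> t * (r t \<bullet> r t))"
      by (simp add: algebra_simps)
    also have "\<dots> \<le> E t0 / \<delta>\<^sup>2 + norm ls * K + \<sigma> / 2 * (K * K / \<mu>)"
      using gap[OF t] lsr mult_left_mono[OF rr, of "\<sigma> / 2"] pos by linarith
    finally show ?thesis .
  qed
  then have "(\<lambda>t. \<bar>f (x t) - f xs\<bar>) \<in> O[at_top](\<lambda>t. 1 / exp (t / \<delta>))"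
    by (intro bigo_inverse_exp_if_bounded[OF \<open>\<mu> > 0\<close> \<beta>]) simp_all
  moreover have "(\<lambda>t. norm (A *v x t - b)) \<in> O[at_top](\<lambda>t. 1 / exp (t / \<delta>))"
    using r_bound by (intro bigo_inverse_exp_if_bounded[OF \<open>\<mu> > 0\<close> \<beta>]) (simp_all add: r_def)
  ultimately show ?thesis
    by simp
qed

end
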